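(* In the setting described in the context (in particular, $Z$ is computed by interval arithmetic applied to the factorable representation of $\boldsymbol{\ell}$), define $$\hat X_k\triangleq\mathbf{E}_f\big((\hat X_{k-1}\times W\times V\times\tilde Z)\cap P_\ell\cap P_y\big)$$ and $$\hat X_k'\triangleq\mathbf{G}_f\big((\hat X_{k-1}\times W\times V\times\tilde Z_{\mathrm r})\cap\mathring P\big)\oplus\mathbf{c}_f,$$ where $\mathbf{G}_f\triangleq\mathbf{E}_{\mathrm r}-\mathbf{E}_{\mathrm e}\mathbf{A}_{\mathrm{ee}}^{-1}\mathbf{A}_{\mathrm{er}}$, $\mathbf{c}_f\triangleq\mathbf{E}_{\mathrm e}\mathbf{A}_{\mathrm{ee}}^{-1}\mathbf{b}_{\mathrm e}$, $\tilde Z_{\mathrm r}$ denotes the last $n_{\mathrm r}-(n_x+n_w+n_v)$ components of $Z_{\mathrm r}$, and $\mathring P\triangleq\{\mathbf{z}_{\mathrm r}\in\mathbb{R}^{n_{\mathrm r}}:\mathring{\mathbf{H}}\mathbf{z}_{\mathrm r}\le\mathring{\mathbf{k}},\ \mathring{\mathbf{A}}\mathbf{z}_{\mathrm r}=\mathring{\mathbf{b}}\}$ with $\mathring{\mathbf{H}}\triangleq\mathbf{H}_{\mathrm r}-\mathbf{H}_{\mathrm e}\mathbf{A}_{\mathrm{ee}}^{-1}\mathbf{A}_{\mathrm{er}}$, $\mathring{\mathbf{k}}\triangleq\mathbf{k}_p-\mathbf{H}_{\mathrm e}\mathbf{A}_{\mathrm{ee}}^{-1}\mathbf{b}_{\mathrm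 e}$, $\mathring{\mathbf{A}}\triangleq\mathbf{A}_{\mathrm{rr}}-\mathbf{A}_{\mathrm{re}}\mathbf{A}_{\mathrm{ee}}^{-1}\mathbf{A}_{\mathrm{er}}$, $\mathring{\mathbf{b}}\triangleq\mathbf{b}_{\mathrm r}-\mathbf{A}_{\mathrm{re}}\mathbf{A}_{\mathrm{ee}}^{-1}\mathbf{b}_{\mathrm e}$. Then $\hat X_k=\hat X_k'$ (equality as sets).
   Context: General notation. A constrained zonotope in $\mathbb{R}^n$ is a set $\{\mathbf{c}+\mathbf{G}\boldsymbol{\xi}:\|\boldsymbol{\xi}\|_\infty\le1,\ \mathbf{A}\boldsymbol{\xi}=\mathbf{b}\}$. For a bounded set $S$, $\square S$ is its interval hull. $\mathbf{R}Y=\{\mathbf{R}\mathbf{y}:\mathbf{y}\in Y\}$; $\oplus$ is the Minkowski sum (with a vector: translation). For compact real intervals $X,Y$ and $\odot\in\{+,-,\times,/\}$, $X\odot Y=\{x\odot y:x\in X,y\in Y\}$ (division only if $0\notin Y$); $\beta(X)$ is the exact image. Factorable function. Fix a library $\mathcal{L}$ of real univariate functions (including $x\mapsto x+q$ and $x\mapsto qx$ for constants $q\in\mathbb{R}$), for which images of compact intervals inside the domain are compact intervals. A function $\boldsymbol{\varphi}:D\subseteq\mathbb{R}^{n_s}\to\mathbb{R}^{n_\varphi}$ is factorable if there are factors $\zeta_j:D\to\mathbb{R}$, $j=1,\ldots,n_z$, with: $\zeta_j(\mathbf{s})=s_j$ for $j\le n_s$; for each $j>n_s$ either $\zeta_j=\zeta_a\odot\zeta_b$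 with $a,b<j$, $\odot\in\{+,-,\times,/\}$, or $\zeta_j=\beta_j(\zeta_a)$ with $a<j$, $\beta_j\in\mathcal{L}$; and $\boldsymbol{\varphi}=\mathbf{E}_\varphi\boldsymbol{\zeta}$ where $\mathbf{E}_\varphi$ is zero except for a single $1$ in each row. The corresponding elementary operations are $\alpha_j(\mathbf{z})=z_j$ for $j\le n_s$, and for $j>n_s$, $\alpha_j(\mathbf{z})=z_a\odot z_b$ or $\alpha_j(\mathbf{z})=\beta_j(z_a)$ respectively. System setting. $\mathbf{f}:\mathbb{R}^{n_x}\times\mathbb{R}^{n_w}\times\mathbb{R}^{n_u}\to\mathbb{R}^{n_x}$ and $\mathbf{g}:\mathbb{R}^{n_x}\times\mathbb{R}^{n_v}\to\mathbb{R}^{n_y}$ are factorable; $\mathbf{u}_{k-1}\in\mathbb{R}^{n_u}$, $\mathbf{y}_k\in\mathbb{R}^{n_y}$ are given; $\hat X_{k-1}\subset\mathbb{R}^{n_x}$, $W\subset\mathbb{R}^{n_w}$, $V\subset\mathbb{R}^{n_v}$ are nonempty constrained zonotopes; $n_s=n_x+n_w+n_v$; $\mathbf{s}=(\mathbf{x}_{k-1},\mathbf{w}_{k-1},\mathbf{v}_k)$; $S=\hat X_{k-1}\times W\times V$. The composite $\boldsymbol{\ell}(\mathbf{s})=\mathbf{g}(\mathbf{f}(\mathbf{x}_{k-1},\mathbf{w}_{k-1},\mathbf{u}_{k-1}),\mathbf{v}_k)$ is factorable with factors $\boldsymbol{\zeta}=(\zeta_1,\ldots,\zeta_{n_z})$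 (on a domain containing $\square S$) and operations $\alpha_1,\ldots,\alpha_{n_z}$, obtained by first factoring $\mathbf{f}(\cdot,\cdot,\mathbf{u}_{k-1})$ and then $\mathbf{g}$; $\mathbf{E}_\ell$, $\mathbf{E}_f$ are matrices with a single $1$ per row and zeros elsewhere such that $\boldsymbol{\ell}(\mathbf{s})=\mathbf{E}_\ell\boldsymbol{\zeta}(\mathbf{s})$ and $\mathbf{f}(\mathbf{x}_{k-1},\mathbf{w}_{k-1},\mathbf{u}_{k-1})=\mathbf{E}_f\boldsymbol{\zeta}(\mathbf{s})$. Enclosures (standing assumption). $Z=Z_1\times\cdots\times Z_{n_z}$ is the interval computed by interval arithmetic from $\square S$: $Z_j=(\square S)_j$ for $j\le n_s$, and for $j>n_s$ recursively $Z_j=Z_a\odot Z_b$ or $Z_j=\beta_j(Z_a)$ according to $\alpha_j$ (all these evaluations are assumed well defined). $\tilde Z$ denotes the last $n_z-n_s$ components of $Z$. $P_\ell=\bigcap_{j=n_s+1}^{n_z}Q_j$, where each $Q_j\subset\mathbb{R}^{n_z}$ is a convex polyhedron given by finitely many linear inequalities and equalities with $Q_j\supseteq\{\mathbf{z}\in Z:z_j=\alpha_j(\mathbf{z})\}$, and, specifically, if $\alpha_j$ is $z_a+z_b$, $z_a-z_b$, $z_a+q_j$ or $q_jz_a$ ($q_j\in\mathbb{R}$ constant), then $Q_j$ is given by the single equality $z_j-z_a-z_b=0$, $z_j-z_a+z_b=0$, $z_j-z_a=q_j$, or $z_j-q_jz_a=0$, respectively (and no inequalities). $P_y=\{\mathbf{z}\in\mathbb{R}^{n_z}:\mathbf{E}_\ell\mathbf{z}=\mathbf{y}_k\}$.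 The representation $P_\ell\cap P_y=\{\mathbf{z}:\mathbf{H}_p\mathbf{z}\le\mathbf{k}_p,\ \mathbf{A}_p\mathbf{z}=\mathbf{b}_p\}$ is obtained by stacking all constraints of the $Q_j$ and of $P_y$. Elimination notation. $\mathcal{I}_{\mathrm e}$ is the set of indices $j\in\{n_s+1,\ldots,n_z\}$ for which $\alpha_j$ is one of the four operations $z_a+z_b$, $z_a-z_b$, $z_a+q_j$, $q_jz_a$; $\mathcal{I}_{\mathrm r}=\{1,\ldots,n_z\}\setminus\mathcal{I}_{\mathrm e}$; $n_{\mathrm e}=|\mathcal{I}_{\mathrm e}|$, $n_{\mathrm r}=|\mathcal{I}_{\mathrm r}|$. $\mathbf{U}$ is the permutation matrix with $\mathbf{U}\mathbf{z}=(\mathbf{z}_{\mathrm e},\mathbf{z}_{\mathrm r})$, where $\mathbf{z}_{\mathrm e}$ (resp. $\mathbf{z}_{\mathrm r}$) collects the $z_j$ with $j\in\mathcal{I}_{\mathrm e}$ (resp. $j\in\mathcal{I}_{\mathrm r}$) in ascending order of $j$; likewise $(Z_{\mathrm e},Z_{\mathrm r})=\mathbf{U}Z$ is the reordering of the components of $Z$. The rows of $(\mathbf{A}_p,\mathbf{b}_p)$ are permuted so that the first $n_{\mathrm e}$ rows are the equalities of $Q_j$, $j\in\mathcal{I}_{\mathrm e}$, in ascending order of $j$, followed by the remaining rows in original order; together with the column permutation, $\mathbf{A}_p\mathbf{z}=\mathbf{b}_p$ becomes $$\begin{bmatrix}\mathbf{A}_{\mathrm{ee}}&\mathbf{A}_{\mathrm{er}}\\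 \mathbf{A}_{\mathrm{re}}&\mathbf{A}_{\mathrm{rr}}\end{bmatrix}\begin{bmatrix}\mathbf{z}_{\mathrm e}\\ \mathbf{z}_{\mathrm r}\end{bmatrix}=\begin{bmatrix}\mathbf{b}_{\mathrm e}\\ \mathbf{b}_{\mathrm r}\end{bmatrix},$$ with $\mathbf{A}_{\mathrm{ee}}\in\mathbb{R}^{n_{\mathrm e}\times n_{\mathrm e}}$, which is invertible (it is lower triangular with unit diagonal). Also $[\mathbf{H}_{\mathrm e}\ \mathbf{H}_{\mathrm r}]=\mathbf{H}_p\mathbf{U}^{-1}$ and $[\mathbf{E}_{\mathrm e}\ \mathbf{E}_{\mathrm r}]=\mathbf{E}_f\mathbf{U}^{-1}$, partitioned conformably with $(\mathbf{z}_{\mathrm e},\mathbf{z}_{\mathrm r})$. *)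

theory Defs
  imports "Jordan_Normal_Form.Gauss_Jordan_Elimination"
begin

text \<open>Indices are 0-based throughout: the inputs of a factorization are the factors
  \<open>0, \<dots>, ns - 1\<close> and the computed factors are \<open>ns, \<dots>, nz - 1\<close>.
  Products of Euclidean spaces are identified with concatenations \<open>x @\<^sub>v w\<close>.\<close>

definition vec_times :: "real vec set \<Rightarrow> real vec set \<Rightarrow> real vec set" (infixr \<open>\<times>\<^sub>v\<close> 75) where
  "A \<times>\<^sub>v B = {a @\<^sub>v b | a b. a \<in> A \<and> b \<in> B}"

definition vec_box :: "real set list \<Rightarrow> real vec set" where
  "vec_box Z = {z \<in> carrier_vec (length Z). \<forall>i < length Z. z $ i \<in> Z ! i}"

definition constrained_zonotope :: "nat \<Rightarrow> real vec set \<Rightarrow> bool" where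
  "constrained_zonotope n X \<longleftrightarrow>
     (\<exists>ng nc c G A b. c \<in> carrier_vec n \<and> G \<in> carrier_mat n ng \<and>
        A \<in> carrier_mat nc ng \<and> b \<in> carrier_vec nc \<and>
        X = {c + G *\<^sub>v \<xi> | \<xi>. \<xi> \<in> carrier_vec ng \<and> (\<forall>i < ng. \<bar>\<xi> $ i\<bar> \<le> 1) \<and> A *\<^sub>v \<xi> = b})"

text \<open>The order on vectors is componentwise, so \<open>{l..u}\<close> is a box.\<close>

definition interval_hull :: "real vec set \<Rightarrow> real vec set" where
  "interval_hull S = \<Inter> {{l..u} | l u. S \<subseteq> {l..u}}"

type_synonym constr = "real vec \<times> real"

definition polyhedron :: "nat \<Rightarrow> constr list \<Rightarrow> constr list \<Rightarrow> real vec set" where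
  "polyhedron n ineqs eqs = {z \<in> carrier_vec n.
     (\<forall>(a, c) \<in> set ineqs. a \<bullet> z \<le> c) \<and> (\<forall>(a, c) \<in> set eqs. a \<bullet> z = c)}"

definition coeff_mat :: "nat \<Rightarrow> constr list \<Rightarrow> real mat" where
  "coeff_mat n cs = mat_of_rows n (map fst cs)"

definition rhs_vec :: "constr list \<Rightarrow> real vec" where
  "rhs_vec cs = vec_of_list (map snd cs)"

definition append_cols :: "real mat \<Rightarrow> real mat \<Rightarrow> real mat" (infixr \<open>@\<^sub>c\<close> 65) where
  "A @\<^sub>c B = four_block_mat A B (0\<^sub>m 0 (dim_col A)) (0\<^sub>m 0 (dim_col B))"

definition mat_inv :: "real mat \<Rightarrow> real mat" where
  "mat_inv A = the (mat_inverse A)"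

text \<open>A single 1 in each row, located in one of the columns \<open>J\<close>, and zeros elsewhere.\<close>

definition selection_mat :: "nat \<Rightarrow> nat \<Rightarrow> nat set \<Rightarrow> real mat \<Rightarrow> bool" where
  "selection_mat nr nc J E \<longleftrightarrow> E \<in> carrier_mat nr nc \<and>
     (\<forall>i < nr. \<exists>j \<in> J. j < nc \<and> row E i = unit_vec nc j)"

definition selected :: "real mat \<Rightarrow> nat set" where
  "selected E = {j. j < dim_col E \<and> (\<exists>i < dim_row E. row E i = unit_vec (dim_col E) j)}"

text \<open>Univariate functions carry their domain: they are partial functions
  \<open>\<beta> :: real \<rightharpoonup> real\<close> with domain \<open>dom \<beta>\<close>.\<close>

definition shift_fun :: "real \<Rightarrow> real \<rightharpoonup> real" where
  "shift_fun q = (\<lambda>x. Some (x + q))"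

definition scale_fun :: "real \<Rightarrow> real \<rightharpoonup> real" where
  "scale_fun q = (\<lambda>x. Some (q * x))"

definition is_library :: "(real \<rightharpoonup> real) set \<Rightarrow> bool" where
  "is_library L \<longleftrightarrow> range shift_fun \<subseteq> L \<and> range scale_fun \<subseteq> L \<and>
     (\<forall>\<beta> \<in> L. \<forall>a b. a \<le> b \<and> {a..b} \<subseteq> dom \<beta> \<longrightarrow>
        (\<exists>c d. c \<le> d \<and> (\<lambda>x. the (\<beta> x)) ` {a..b} = {c..d}))"

datatype arith_op = Plus | Minus | Times | Divide

datatype elem_op =
    Bin arith_op nat nat
  | Uni "real \<rightharpoonup> real" nat

fun op_args :: "elem_op \<Rightarrow> nat set" where
  "op_args (Bin _ a b) = {a, b}"
| "op_args (Uni _ a) = {a}"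

fun op_in_library :: "(real \<rightharpoonup> real) set \<Rightarrow> elem_op \<Rightarrow> bool" where
  "op_in_library L (Bin _ _ _) \<longleftrightarrow> True"
| "op_in_library L (Uni \<beta> _) \<longleftrightarrow> \<beta> \<in> L"

fun op_value :: "elem_op \<Rightarrow> real vec \<Rightarrow> real option" where
  "op_value (Bin Plus a b) z = Some (z $ a + z $ b)"
| "op_value (Bin Minus a b) z = Some (z $ a - z $ b)"
| "op_value (Bin Times a b) z = Some (z $ a * z $ b)"
| "op_value (Bin Divide a b) z = (if z $ b = 0 then None else Some (z $ a / z $ b))"
| "op_value (Uni \<beta> a) z = \<beta> (z $ a)"

text \<open>Interval evaluation of an operation; \<open>None\<close> if it is not well defined on the operands.\<close>

fun op_interval :: "elem_op \<Rightarrow> real set list \<Rightarrow> real set option" where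
  "op_interval (Bin Plus a b) Z = Some {x + y | x y. x \<in> Z ! a \<and> y \<in> Z ! b}"
| "op_interval (Bin Minus a b) Z = Some {x - y | x y. x \<in> Z ! a \<and> y \<in> Z ! b}"
| "op_interval (Bin Times a b) Z = Some {x * y | x y. x \<in> Z ! a \<and> y \<in> Z ! b}"
| "op_interval (Bin Divide a b) Z =
     (if 0 \<in> Z ! b then None else Some {x / y | x y. x \<in> Z ! a \<and> y \<in> Z ! b})"
| "op_interval (Uni \<beta> a) Z =
     (if Z ! a \<subseteq> dom \<beta> then Some ((\<lambda>x. the (\<beta> x)) ` (Z ! a)) else None)"

text \<open>\<open>\<zeta>\<close> is the vector of factors on \<open>D\<close> generated by the operations \<open>\<alpha> ns, \<dots>, \<alpha> (nz - 1)\<close>.\<close>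

definition factors :: "(real \<rightharpoonup> real) set \<Rightarrow> real vec set \<Rightarrow> nat \<Rightarrow> nat \<Rightarrow>
    (nat \<Rightarrow> elem_op) \<Rightarrow> (real vec \<Rightarrow> real vec) \<Rightarrow> bool" where
  "factors L D ns nz \<alpha> \<zeta> \<longleftrightarrow> D \<subseteq> carrier_vec ns \<and> ns \<le> nz \<and>
     (\<forall>j \<in> {ns..<nz}. op_args (\<alpha> j) \<subseteq> {..<j} \<and> op_in_library L (\<alpha> j)) \<and>
     (\<forall>s \<in> D. \<zeta> s \<in> carrier_vec nz \<and> (\<forall>j < ns. \<zeta> s $ j = s $ j) \<and>
        (\<forall>j \<in> {ns..<nz}. op_value (\<alpha> j) (\<zeta> s) = Some (\<zeta> s $ j)))"

definition factorable :: "(real \<rightharpoonup> real) set \<Rightarrow> real vec set \<Rightarrow> nat \<Rightarrow> nat \<Rightarrow>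
    (real vec \<Rightarrow> real vec) \<Rightarrow> bool" where
  "factorable L D ns m \<phi> \<longleftrightarrow> (\<exists>nz \<alpha> \<zeta> E. factors L D ns nz \<alpha> \<zeta> \<and>
     selection_mat m nz {..<nz} E \<and> (\<forall>s \<in> D. \<phi> s = E *\<^sub>v \<zeta> s))"

text \<open>A factorization of \<open>(x, w, v) \<mapsto> g (f (x, w, u), v)\<close> that first factors
  \<open>(x, w) \<mapsto> f (x, w, u)\<close>, using the factors \<open>x\<close>, \<open>w\<close> and \<open>ns, \<dots>, nf - 1\<close> only, and then
  \<open>g\<close>, whose inputs are the factors selected by \<open>Ef\<close> and the factors \<open>v\<close>.\<close>

definition first_f_then_g :: "nat \<Rightarrow> nat \<Rightarrow> nat \<Rightarrow> nat \<Rightarrow> nat \<Rightarrow>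
    (nat \<Rightarrow> elem_op) \<Rightarrow> real mat \<Rightarrow> real mat \<Rightarrow> nat \<Rightarrow> nat \<Rightarrow> bool" where
  "first_f_then_g nx nw nv nf nz \<alpha> Ef El mf mg \<longleftrightarrow>
     (let ns = nx + nw + nv;
          in_f = {..<nx + nw};
          in_g = selected Ef \<union> {nx + nw..<ns}
      in ns \<le> nf \<and> nf \<le> nz \<and>
         (\<forall>j \<in> {ns..<nf}. op_args (\<alpha> j) \<subseteq> in_f \<union> {ns..<j}) \<and>
         selection_mat mf nz (in_f \<union> {ns..<nf}) Ef \<and>
         (\<forall>j \<in> {nf..<nz}. op_args (\<alpha> j) \<subseteq> in_g \<union> {nf..<j}) \<and>
         selection_mat mg nz (in_g \<union> {nf..<nz}) El)"

fun is_linear_op :: "elem_op \<Rightarrow> bool" where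
  "is_linear_op (Bin c _ _) \<longleftrightarrow> c = Plus \<or> c = Minus"
| "is_linear_op (Uni \<beta> _) \<longleftrightarrow> (\<exists>q. \<beta> = shift_fun q \<or> \<beta> = scale_fun q)"

definition subvec :: "real vec \<Rightarrow> nat set \<Rightarrow> real vec" where
  "subvec z I = vec_of_list (nths (list_of_vec z) I)"

text \<open>All inequalities, resp. equalities, of \<open>Q\<^sub>j\<close> for \<open>j \<in> {ns..<nz} \<inter> J\<close>, in ascending order of \<open>j\<close>.\<close>

definition stack :: "nat \<Rightarrow> nat \<Rightarrow> nat set \<Rightarrow> (nat \<Rightarrow> constr list) \<Rightarrow> constr list" where
  "stack ns nz J Q = concat (map Q (filter (\<lambda>j. j \<in> J) [ns..<nz]))"

definition output_eqs :: "real mat \<Rightarrow> real vec \<Rightarrow> constr list" where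
  "output_eqs E y = zip (rows E) (list_of_vec y)"

end

theory Submission
  imports Defs "Jordan_Normal_Form.Determinant"
begin

text \<open>The equality of a linear operation determines \<open>z\<^sub>j\<close> from the factors before it, so by
  induction on \<open>j\<close> a solution of the homogeneous equalities that vanishes on \<open>I\<^sub>r\<close> is zero. Hence
  \<open>A\<^sub>e\<^sub>e\<close> is invertible, and on \<open>P\<^sub>\<ell> \<inter> P\<^sub>y\<close> the components \<open>z\<^sub>e\<close> are an affine function of \<open>z\<^sub>r\<close>;
  substituting it turns the remaining constraints and the output map into those of the reduced set.
  The bounds \<open>z\<^sub>j \<in> Z\<^sub>j\<close> with \<open>j \<in> I\<^sub>e\<close>, which the reduced set drops, are redundant: \<open>Z\<^sub>j\<close> is the
  interval evaluation of the operation, so they follow by another induction on \<open>j\<close> from the bounds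
  on the arguments.\<close>

text \<open>\<open>mat_inv\<close> applies \<open>the\<close> to a partial inverse, so
  \<open>None\<close> has to be ruled out. A trivial kernel makes the determinant nonzero and hence
  the matrix a unit of the matrix ring, for which \<open>mat_inverse\<close> succeeds. The kernel
  criterion suits \<open>U\<close> and \<open>Aee\<close>, which are easier to reach through their
  action than through their entries.\<close>

lemma mat_inv:
  assumes A: "A \<in> carrier_mat n n"
    and inj: "\<And>v. v \<in> carrier_vec n \<Longrightarrow> A *\<^sub>v v = 0\<^sub>v n \<Longrightarrow> v = 0\<^sub>v n"
  shows "mat_inv A \<in> carrier_mat n n" "A * mat_inv A = 1\<^sub>m n" "mat_inv A * A = 1\<^sub>m n"
proof -
  have "det A \<noteq> 0"
    using inj det_0_iff_vec_prod_zero[OF A] by blast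
  then have "A \<in> Units (ring_mat TYPE(real) n ())"
    by (rule det_non_zero_imp_unit[OF A])
  then obtain B where "mat_inverse A = Some B"
    using mat_inverse(1)[OF A, of "()"] by (cases "mat_inverse A") auto
  then show "mat_inv A \<in> carrier_mat n n" "A * mat_inv A = 1\<^sub>m n" "mat_inv A * A = 1\<^sub>m n"
    using mat_inverse(2)[OF A] by (simp_all add: mat_inv_def)
qed

text \<open>The lower blocks in \<open>append_cols\<close> have no rows, so they only append a
  vector of dimension 0.\<close>

lemma append_cols_mult_vec:
  assumes "A \<in> carrier_mat k m" "B \<in> carrier_mat k n" "v \<in> carrier_vec m" "w \<in> carrier_vec n"
  shows "(A @\<^sub>c B) *\<^sub>v (v @\<^sub>v w) = A *\<^sub>v v + B *\<^sub>v w"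
proof -
  have "(A @\<^sub>c B) *\<^sub>v (v @\<^sub>v w) =
      (A *\<^sub>v v + B *\<^sub>v w) @\<^sub>v (0\<^sub>m 0 m *\<^sub>v v + 0\<^sub>m 0 n *\<^sub>v w)"
    unfolding append_cols_def using assms by (subst four_block_mat_mult_vec) auto
  also have "\<dots> = A *\<^sub>v v + B *\<^sub>v w"
    by (rule eq_vecI) (use assms in \<open>auto\<close>)
  finally show ?thesis .
qed

text \<open>The eliminated components are replaced by
  \<open>B *\<^sub>v (b - A *\<^sub>v z)\<close>, and the part linear in \<open>z\<close> is
  separated from the constant one. The row number \<open>k\<close> is arbitrary so that the output
  map, the inequalities and the remaining equalities are all covered.\<close>

lemma substitute_mult_vec:
  fixes M\<^sub>e :: "'a :: comm_ring_1 mat"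
  assumes Me: "M\<^sub>e \<in> carrier_mat k m" and Mr: "M\<^sub>r \<in> carrier_mat k n"
    and B: "B \<in> carrier_mat m m" and A: "A \<in> carrier_mat m n"
    and b: "b \<in> carrier_vec m" and z: "z \<in> carrier_vec n"
  shows "M\<^sub>e *\<^sub>v (B *\<^sub>v (b - A *\<^sub>v z)) + M\<^sub>r *\<^sub>v z =
    (M\<^sub>r - M\<^sub>e * B * A) *\<^sub>v z + M\<^sub>e * B *\<^sub>v b"
proof -
  have MB: "M\<^sub>e * B \<in> carrier_mat k m" and Az: "A *\<^sub>v z \<in> carrier_vec m"
    using assms by auto
  have "M\<^sub>e *\<^sub>v (B *\<^sub>v (b - A *\<^sub>v z)) = M\<^sub>e * B *\<^sub>v (b - A *\<^sub>v z)"
    using Me B b Az by (simp add: assoc_mult_mat_vec[of _ k m _ m])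
  also have "\<dots> = M\<^sub>e * B *\<^sub>v b - M\<^sub>e * B *\<^sub>v (A *\<^sub>v z)"
    by (rule mult_minus_distrib_mat_vec[OF MB b Az])
  finally have 1: "M\<^sub>e *\<^sub>v (B *\<^sub>v (b - A *\<^sub>v z)) = \<dots>" .
  have "(M\<^sub>r - M\<^sub>e * B * A) *\<^sub>v z = M\<^sub>r *\<^sub>v z - M\<^sub>e * B * A *\<^sub>v z"
    using MB A Mr z by (intro minus_mult_distrib_mat_vec) auto
  also have "M\<^sub>e * B * A *\<^sub>v z = M\<^sub>e * B *\<^sub>v (A *\<^sub>v z)"
    by (rule assoc_mult_mat_vec[OF MB A z])
  finally show ?thesis
    unfolding 1 by (intro eq_vecI) (use assms MB in \<open>auto\<close>)
qed

section \<open>Constraint lists as linear systems\<close>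

lemma coeff_mat_carrier [simp]: "coeff_mat n cs \<in> carrier_mat (length cs) n"
  by (simp add: coeff_mat_def mat_of_rows_def)

lemma dim_row_coeff_mat [simp]: "dim_row (coeff_mat n cs) = length cs"
  by (simp add: coeff_mat_def)

lemma rhs_vec_carrier [simp]: "rhs_vec cs \<in> carrier_vec (length cs)"
  by (simp add: rhs_vec_def carrier_vecI)

lemma rhs_vec_append: "rhs_vec (cs @ ds) = rhs_vec cs @\<^sub>v rhs_vec ds"
  by (rule eq_vecI) (auto simp: rhs_vec_def vec_of_list_index nth_append simp del: vec_of_list_map)

text \<open>\<open>mat_of_rows\<close> builds rows of dimension \<open>n\<close>, so a row is the
  given coefficient vector only when that vector has dimension \<open>n\<close> too.\<close>

lemma coeff_mat_mult_vec_index: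
  assumes "fst ` set cs \<subseteq> carrier_vec n" "i < length cs"
  shows "(coeff_mat n cs *\<^sub>v z) $ i = fst (cs ! i) \<bullet> z"
proof -
  have "fst (cs ! i) \<in> carrier_vec n"
    using assms nth_mem by blast
  then show ?thesis
    using assms by (simp add: coeff_mat_def)
qed

lemma coeff_mat_append_mult_vec:
  assumes "fst ` set cs \<subseteq> carrier_vec n" "fst ` set ds \<subseteq> carrier_vec n"
  shows "coeff_mat n (cs @ ds) *\<^sub>v z = coeff_mat n cs *\<^sub>v z @\<^sub>v coeff_mat n ds *\<^sub>v z"
proof (rule eq_vecI)
  show "dim_vec (coeff_mat n (cs @ ds) *\<^sub>v z) =
      dim_vec (coeff_mat n cs *\<^sub>v z @\<^sub>v coeff_mat n ds *\<^sub>v z)"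
    by (simp add: coeff_mat_def)
  fix i assume "i < dim_vec (coeff_mat n cs *\<^sub>v z @\<^sub>v coeff_mat n ds *\<^sub>v z)"
  then have i: "i < length (cs @ ds)"
    by (simp add: coeff_mat_def)
  have 1: "(coeff_mat n (cs @ ds) *\<^sub>v z) $ i = fst ((cs @ ds) ! i) \<bullet> z"
    using assms i by (intro coeff_mat_mult_vec_index) auto
  show "(coeff_mat n (cs @ ds) *\<^sub>v z) $ i =
      (coeff_mat n cs *\<^sub>v z @\<^sub>v coeff_mat n ds *\<^sub>v z) $ i"
    unfolding 1 using assms i
    by (cases "i < length cs")
       (auto simp: nth_append coeff_mat_mult_vec_index simp del: index_mult_mat_vec)
qed

lemma coeff_mat_mult_vec_eq_iff:
  assumes "fst ` set cs \<subseteq> carrier_vec n"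
  shows "coeff_mat n cs *\<^sub>v z = rhs_vec cs \<longleftrightarrow> (\<forall>(a, c) \<in> set cs. a \<bullet> z = c)"
proof -
  have "coeff_mat n cs *\<^sub>v z = rhs_vec cs \<longleftrightarrow>
      (\<forall>i < length cs. fst (cs ! i) \<bullet> z = snd (cs ! i))"
    unfolding vec_eq_iff using coeff_mat_mult_vec_index[OF assms]
    by (auto simp: rhs_vec_def vec_of_list_index coeff_mat_def
             simp del: index_mult_mat_vec vec_of_list_map)
  then show ?thesis
    by (auto simp: all_set_conv_all_nth split_beta)
qed

lemma coeff_mat_mult_vec_le_iff:
  assumes "fst ` set cs \<subseteq> carrier_vec n"
  shows "coeff_mat n cs *\<^sub>v z \<le> rhs_vec cs \<longleftrightarrow> (\<forall>(a, c) \<in> set cs. a \<bullet> z \<le> c)"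
proof -
  have "coeff_mat n cs *\<^sub>v z \<le> rhs_vec cs \<longleftrightarrow>
      (\<forall>i < length cs. fst (cs ! i) \<bullet> z \<le> snd (cs ! i))"
    unfolding less_eq_vec_def using coeff_mat_mult_vec_index[OF assms]
    by (auto simp: rhs_vec_def vec_of_list_index coeff_mat_def
             simp del: index_mult_mat_vec vec_of_list_map)
  then show ?thesis
    by (auto simp: all_set_conv_all_nth split_beta)
qed

lemma set_stack: "set (stack ns nz J Q) = (\<Union>j \<in> {ns..<nz} \<inter> J. set (Q j))"
  by (auto simp: stack_def)

lemma fst_stack:
  assumes "\<And>j c. j \<in> {ns..<nz} \<Longrightarrow> c \<in> set (Q j) \<Longrightarrow> fst c \<in> C"
  shows "fst ` set (stack ns nz J Q) \<subseteq> C"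
  using assms by (auto simp only: set_stack)

text \<open>Every eliminated factor contributes exactly one equality; this count is what makes the
  leading block of equalities square.\<close>

lemma length_stack_singletons:
  assumes "\<And>j. j \<in> {ns..<nz} \<inter> J \<Longrightarrow> length (Q j) = 1"
  shows "length (stack ns nz J Q) = card ({ns..<nz} \<inter> J)"
proof -
  let ?js = "filter (\<lambda>j. j \<in> J) [ns..<nz]"
  have "length (stack ns nz J Q) = sum_list (map (\<lambda>j. 1) ?js)"
    unfolding stack_def length_concat map_map
    by (rule arg_cong[where f = sum_list], rule map_cong) (use assms in auto)
  also have "\<dots> = length ?js"
    by (simp add: sum_list_triv)
  also have "\<dots> = card (set ?js)"
    by (rule distinct_card[symmetric]) simp
  also have "set ?js = {ns..<nz} \<inter> J"
    by auto
  finally show ?thesis .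
qed

lemma output_eqs_iff:
  assumes E: "E \<in> carrier_mat m n" and y: "y \<in> carrier_vec m"
  shows "(\<forall>(a, c) \<in> set (output_eqs E y). a \<bullet> z = c) \<longleftrightarrow> E *\<^sub>v z = y"
proof -
  have "(\<forall>(a, c) \<in> set (output_eqs E y). a \<bullet> z = c) \<longleftrightarrow> (\<forall>i < m. row E i \<bullet> z = y $ i)"
    using assms by (fastforce simp: output_eqs_def set_zip list_of_vec_index)
  then show ?thesis
    using assms by (auto simp: vec_eq_iff)
qed

lemma fst_output_eqs:
  assumes "E \<in> carrier_mat m n"
  shows "fst ` set (output_eqs E y) \<subseteq> carrier_vec n"
  using assms rows_carrier[of E] by (auto simp: output_eqs_def dest!: set_zip_leftD)

section \<open>Subvectors, boxes and products\<close>

lemma list_all2_nths: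
  assumes "length xs = length ys"
  shows "list_all2 P (nths xs I) (nths ys I) \<longleftrightarrow>
    (\<forall>j < length xs. j \<in> I \<longrightarrow> P (xs ! j) (ys ! j))"
  \<comment> \<open>\<open>I\<close> is generalised because passing to the tails of the lists shifts
    the index set by one.\<close>
  using assms
  by (induction xs ys arbitrary: I rule: list_induct2) (auto simp: nths_Cons All_less_Suc2)

text \<open>In this form \<open>list_all2_nths\<close> applies to boxes, with \<open>(\<in>)\<close>
  as the relation; with \<open>(=)\<close> it serves equality of subvectors.\<close>

lemma mem_vec_box_iff: "z \<in> vec_box Z \<longleftrightarrow> list_all2 (\<in>) (list_of_vec z) Z"
  unfolding vec_box_def list_all2_conv_all_nth mem_Collect_eq carrier_dim_vec
  by (simp add: list_of_vec_index cong: conj_cong)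

lemma dim_subvec: "dim_vec (subvec z I) = card {j. j < dim_vec z \<and> j \<in> I}"
  by (simp add: subvec_def length_nths)

lemma subvec_eqD:
  assumes "subvec z I = subvec z' I" "dim_vec z = dim_vec z'" "j < dim_vec z" "j \<in> I"
  shows "z $ j = z' $ j"
proof -
  have "nths (list_of_vec z) I = nths (list_of_vec z') I"
    using arg_cong[OF assms(1), of list_of_vec] by (simp add: subvec_def list_vec)
  then have "list_all2 (=) (nths (list_of_vec z) I) (nths (list_of_vec z') I)"
    by (simp add: list.rel_eq)
  then show ?thesis
    using assms(2-) by (simp add: list_all2_nths list_of_vec_index)
qed

lemma subvec_mem_vec_box_iff:
  assumes "dim_vec z = length Z"
  shows "subvec z I \<in> vec_box (nths Z I) \<longleftrightarrow> (\<forall>j < length Z. j \<in> I \<longrightarrow> z $ j \<in> Z ! j)"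
  using assms by (simp add: mem_vec_box_iff subvec_def list_vec list_all2_nths list_of_vec_index)

lemma subvec_append:
  assumes "{..<dim_vec s} \<subseteq> I"
  shows "subvec (s @\<^sub>v t) I = s @\<^sub>v subvec t {j. j + dim_vec s \<in> I}"
proof -
  have "nths (list_of_vec s) I = list_of_vec s"
    using assms by (intro nths_all) auto
  then have "list_of_vec (subvec (s @\<^sub>v t) I) = list_of_vec (s @\<^sub>v subvec t {j. j + dim_vec s \<in> I})"
    by (simp add: subvec_def list_vec nths_append)
  then have "vec_of_list (list_of_vec (subvec (s @\<^sub>v t) I)) =
      vec_of_list (list_of_vec (s @\<^sub>v subvec t {j. j + dim_vec s \<in> I}))"
    by (rule arg_cong)
  then show ?thesis
    by (simp only: vec_list)
qed

lemma subvec_UNIV [simp]: "subvec z UNIV = z"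
  by (simp add: subvec_def vec_list nths_all)

text \<open>The products defining \<open>Xk\<close> and \<open>Xk'\<close> nest to the right, so
  regrouping is needed to isolate \<open>S\<close> as the first factor.\<close>

lemma vec_times_assoc: "(A \<times>\<^sub>v B) \<times>\<^sub>v C = A \<times>\<^sub>v B \<times>\<^sub>v C"
proof -
  have assoc: "(a @\<^sub>v b) @\<^sub>v c = a @\<^sub>v b @\<^sub>v c" for a b c :: "real vec"
    by (rule eq_vecI) auto
  show ?thesis
  proof (intro equalityI subsetI)
    fix x assume "x \<in> (A \<times>\<^sub>v B) \<times>\<^sub>v C"
    then show "x \<in> A \<times>\<^sub>v B \<times>\<^sub>v C"
      unfolding vec_times_def using assoc by blast
  next
    fix x assume "x \<in> A \<times>\<^sub>v B \<times>\<^sub>v C"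
    then obtain a b c where x: "x = (a @\<^sub>v b) @\<^sub>v c" and "a \<in> A" "b \<in> B" "c \<in> C"
      unfolding vec_times_def using assoc by auto
    then show "x \<in> (A \<times>\<^sub>v B) \<times>\<^sub>v C"
      unfolding vec_times_def by blast
  qed
qed

lemma vec_times_carrier:
  "A \<subseteq> carrier_vec m \<Longrightarrow> B \<subseteq> carrier_vec n \<Longrightarrow> A \<times>\<^sub>v B \<subseteq> carrier_vec (m + n)"
  by (auto simp: vec_times_def)

text \<open>The common dimension \<open>n\<close> fixes where the concatenation is cut, which makes
  the decomposition unique.\<close>

lemma append_mem_vec_times_iff:
  assumes "S \<subseteq> carrier_vec n" "s \<in> carrier_vec n"
  shows "s @\<^sub>v t \<in> S \<times>\<^sub>v B \<longleftrightarrow> s \<in> S \<and> t \<in> B"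
proof
  assume "s @\<^sub>v t \<in> S \<times>\<^sub>v B"
  then obtain a b where "s @\<^sub>v t = a @\<^sub>v b" "a \<in> S" "b \<in> B"
    unfolding vec_times_def by auto
  then show "s \<in> S \<and> t \<in> B"
    using assms append_vec_eq[of s n a t b] by auto
qed (auto simp: vec_times_def)

text \<open>Stated for any \<open>I\<close> containing the inputs, so that \<open>UNIV\<close> gives
  the original set and \<open>Ir\<close> the reduced one. Both then appear as the same condition on
  \<open>z\<close>, up to the range of the bounds.\<close>

lemma subvec_mem_times_box_iff:
  assumes S: "S \<subseteq> carrier_vec ns" and z: "z \<in> carrier_vec (length Z)"
    and ns: "ns \<le> length Z" and I: "{..<ns} \<subseteq> I"
  shows "subvec z I \<in> S \<times>\<^sub>v vec_box (drop ns (nths Z I)) \<longleftrightarrow>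
    vec_first z ns \<in> S \<and> (\<forall>j \<in> {ns..<length Z} \<inter> I. z $ j \<in> Z ! j)"
proof -
  define m where "m = length Z - ns"
  \<comment> \<open>\<open>J\<close> is \<open>I\<close> shifted back by \<open>ns\<close>, the
    index set as seen from the tail \<open>t\<close>.\<close>
  define s t J where "s = vec_first z ns" and "t = vec_last z m" and "J = {j. j + ns \<in> I}"
  have zst: "z = s @\<^sub>v t" and s: "s \<in> carrier_vec ns" and t: "t \<in> carrier_vec m"
    unfolding s_def t_def using z ns by (auto simp: m_def)
  have "nths (take ns Z) I = take ns Z"
    using I by (intro nths_all) auto
  then have "nths Z I = take ns Z @ nths (drop ns Z) J"
    using nths_append[of "take ns Z" "drop ns Z" I] ns by (simp add: J_def min_absorb2)
  then have drop: "drop ns (nths Z I) = nths (drop ns Z) J"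
    using ns by simp
  have "subvec z I = s @\<^sub>v subvec t J"
    unfolding zst using s I by (subst subvec_append) (auto simp: J_def)
  then have "subvec z I \<in> S \<times>\<^sub>v vec_box (drop ns (nths Z I)) \<longleftrightarrow>
      s \<in> S \<and> (\<forall>j < m. j \<in> J \<longrightarrow> t $ j \<in> drop ns Z ! j)"
    using t by (simp add: drop append_mem_vec_times_iff[OF S s] subvec_mem_vec_box_iff m_def)
  also have "(\<forall>j < m. j \<in> J \<longrightarrow> t $ j \<in> drop ns Z ! j) \<longleftrightarrow>
      (\<forall>j \<in> {ns..<length Z} \<inter> I. z $ j \<in> Z ! j)"
  proof -
    have tz: "t $ j = z $ (j + ns)" if "j < m" for j
      unfolding zst using that s t by simp
    show ?thesis
    proof (intro iffI ballI allI impI)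
      fix j assume *: "\<forall>j < m. j \<in> J \<longrightarrow> t $ j \<in> drop ns Z ! j"
        and "j \<in> {ns..<length Z} \<inter> I"
      then have "j - ns < m" "j - ns \<in> J" "j - ns + ns = j"
        by (auto simp: m_def J_def)
      then show "z $ j \<in> Z ! j"
        using *[rule_format, of "j - ns"] tz[of "j - ns"] ns by (simp add: add.commute)
    next
      fix j assume *: "\<forall>j \<in> {ns..<length Z} \<inter> I. z $ j \<in> Z ! j" and "j < m" "j \<in> J"
      then show "t $ j \<in> drop ns Z ! j"
        using ns by (auto simp: tz m_def J_def add.commute)
    qed
  qed
  finally show ?thesis
    by (simp add: s_def)
qed

section \<open>Interval evaluation and the equations of linear operations\<close>

lemma constrained_zonotope_carrier: "constrained_zonotope n X \<Longrightarrow> X \<subseteq> carrier_vec n"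
  unfolding constrained_zonotope_def by (auto intro!: add_carrier_vec mult_mat_vec_carrier)

lemma subset_interval_hull: "S \<subseteq> interval_hull S"
  by (auto simp: interval_hull_def)

text \<open>An interval evaluation is the image of the operand intervals, so it contains the value
  at any point whose operands lie in them. This is the induction step for the dropped
  bounds.\<close>

lemma op_value_mem_op_interval:
  assumes "op_interval op Z = Some X" "op_value op z = Some r"
    and "\<And>a. a \<in> op_args op \<Longrightarrow> z $ a \<in> Z ! a"
  shows "r \<in> X"
  using assms
proof (cases op)
  case (Bin c a b)
  then show ?thesis
    using assms by (cases c) (auto split: if_splits)
next
  case (Uni \<beta> a)
  then show ?thesis
    using assms by (force split: if_splits)
qed

text \<open>The last conjunct, about the homogeneous equation, is what makes the block
  \<open>A\<^sub>e\<^sub>e\<close> injective.\<close>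

lemma linear_op_equation:
  assumes "is_linear_op op" "op_args op \<subseteq> {..<j}" and j: "j < n"
    and "\<And>a b. op = Bin Plus a b \<Longrightarrow> Q = [(unit_vec n j - unit_vec n a - unit_vec n b, 0)]"
    and "\<And>a b. op = Bin Minus a b \<Longrightarrow> Q = [(unit_vec n j - unit_vec n a + unit_vec n b, 0)]"
    and "\<And>a q. op = Uni (shift_fun q) a \<Longrightarrow> Q = [(unit_vec n j - unit_vec n a, q)]"
    and "\<And>a q. op = Uni (scale_fun q) a \<Longrightarrow> Q = [(unit_vec n j - q \<cdot>\<^sub>v unit_vec n a, 0)]"
  shows "\<exists>p c. Q = [(p, c)] \<and> (\<forall>z \<in> carrier_vec n.
    (p \<bullet> z = c \<longrightarrow> op_value op z = Some (z $ j)) \<and>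
    (p \<bullet> z = 0 \<longrightarrow> (\<forall>a \<in> op_args op. z $ a = 0) \<longrightarrow> z $ j = 0))"
proof -
  note distrib = minus_scalar_prod_distrib[of _ n] add_scalar_prod_distrib[of _ n]
    smult_scalar_prod_distrib[of _ n]
  show ?thesis
  proof (cases op)
    case (Bin c a b)
    then have "a < n" "b < n"
      using assms(2) j by auto
    then show ?thesis
      using assms Bin by (cases c) (auto simp: distrib)
  next
    case (Uni \<beta> a)
    then have "a < n"
      using assms(2) j by auto
    then show ?thesis
      using assms Uni by (auto simp: distrib shift_fun_def scale_fun_def)
  qed
qed

lemma add_vec_eq_iff_eq_minus:
  fixes a :: "'a :: group_add vec"
  assumes "a \<in> carrier_vec n" "b \<in> carrier_vec n" "c \<in> carrier_vec n"
  shows "a + b = c \<longleftrightarrow> a = c - b"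
  using assms by (auto simp: vec_eq_iff eq_diff_eq)

lemma add_vec_le_iff_le_minus:
  fixes a :: "real vec"
  assumes "a \<in> carrier_vec n" "b \<in> carrier_vec n" "c \<in> carrier_vec n"
  shows "a + b \<le> c \<longleftrightarrow> a \<le> c - b"
  using assms by (auto simp: less_eq_vec_def le_diff_eq)

theorem corollary1:
  fixes nx nw nv nu ny ns nf nz ne nr nh mr :: nat
    and L :: "(real \<rightharpoonup> real) set"
    and f g l \<zeta> :: "real vec \<Rightarrow> real vec"
    and u y be br kp cf ko bo :: "real vec"
    and Xprev W V S D Pl Py Po Xk Xk' :: "real vec set"
    and \<alpha> :: "nat \<Rightarrow> elem_op"
    and Z :: "real set list"
    and Qineq Qeq :: "nat \<Rightarrow> constr list"
    and eqs_p :: "constr list"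
    and Ie Ir :: "nat set"
    and Ef El U Hp Aee Aer Are Arr He Hr Ee Er Gf Ho Ao :: "real mat"
  assumes L: "is_library L"
    and f: "factorable L (carrier_vec (nx + nw + nu)) (nx + nw + nu) nx f"
    and g: "factorable L (carrier_vec (nx + nv)) (nx + nv) ny g"
    and u: "u \<in> carrier_vec nu"
    and y: "y \<in> carrier_vec ny"
    and Xprev: "constrained_zonotope nx Xprev" "Xprev \<noteq> {}"
    and W: "constrained_zonotope nw W" "W \<noteq> {}"
    and V: "constrained_zonotope nv V" "V \<noteq> {}"
    and ns: "ns = nx + nw + nv"
    and S: "S = Xprev \<times>\<^sub>v W \<times>\<^sub>v V"
    and l: "\<And>x w v. x \<in> carrier_vec nx \<Longrightarrow> w \<in> carrier_vec nw \<Longrightarrow> v \<in> carrier_vec nv \<Longrightarrow>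
              l (x @\<^sub>v w @\<^sub>v v) = g (f (x @\<^sub>v w @\<^sub>v u) @\<^sub>v v)"
    and fac: "factors L D ns nz \<alpha> \<zeta>"
    and D: "interval_hull S \<subseteq> D"
    and composite: "first_f_then_g nx nw nv nf nz \<alpha> Ef El nx ny"
    and El: "\<And>s. s \<in> D \<Longrightarrow> l s = El *\<^sub>v \<zeta> s"
    and Ef: "\<And>x w v. x \<in> carrier_vec nx \<Longrightarrow> w \<in> carrier_vec nw \<Longrightarrow> v \<in> carrier_vec nv \<Longrightarrow>
              x @\<^sub>v w @\<^sub>v v \<in> D \<Longrightarrow> f (x @\<^sub>v w @\<^sub>v u) = Ef *\<^sub>v \<zeta> (x @\<^sub>v w @\<^sub>v v)"
    and Z_length: "length Z = nz"
    and Z_in: "\<And>j. j < ns \<Longrightarrow> Z ! j = (\<lambda>s. s $ j) ` interval_hull S"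
    and Z_op: "\<And>j. ns \<le> j \<Longrightarrow> j < nz \<Longrightarrow> op_interval (\<alpha> j) Z = Some (Z ! j)"
    and Q_dim: "\<And>j a c. ns \<le> j \<Longrightarrow> j < nz \<Longrightarrow> (a, c) \<in> set (Qineq j) \<union> set (Qeq j) \<Longrightarrow>
              a \<in> carrier_vec nz"
    and Q_encl: "\<And>j. ns \<le> j \<Longrightarrow> j < nz \<Longrightarrow>
              {z \<in> vec_box Z. op_value (\<alpha> j) z = Some (z $ j)} \<subseteq> polyhedron nz (Qineq j) (Qeq j)"
    and Q_plus: "\<And>j a b. ns \<le> j \<Longrightarrow> j < nz \<Longrightarrow> \<alpha> j = Bin Plus a b \<Longrightarrow>
              Qineq j = [] \<and> Qeq j = [(unit_vec nz j - unit_vec nz a - unit_vec nz b, 0)]"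
    and Q_minus: "\<And>j a b. ns \<le> j \<Longrightarrow> j < nz \<Longrightarrow> \<alpha> j = Bin Minus a b \<Longrightarrow>
              Qineq j = [] \<and> Qeq j = [(unit_vec nz j - unit_vec nz a + unit_vec nz b, 0)]"
    and Q_shift: "\<And>j a q. ns \<le> j \<Longrightarrow> j < nz \<Longrightarrow> \<alpha> j = Uni (shift_fun q) a \<Longrightarrow>
              Qineq j = [] \<and> Qeq j = [(unit_vec nz j - unit_vec nz a, q)]"
    and Q_scale: "\<And>j a q. ns \<le> j \<Longrightarrow> j < nz \<Longrightarrow> \<alpha> j = Uni (scale_fun q) a \<Longrightarrow>
              Qineq j = [] \<and> Qeq j = [(unit_vec nz j - q \<cdot>\<^sub>v unit_vec nz a, 0)]"
    and Pl: "Pl = (\<Inter>j \<in> {ns..<nz}. polyhedron nz (Qineq j) (Qeq j))"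
    and Py: "Py = {z \<in> carrier_vec nz. El *\<^sub>v z = y}"
    and Hp: "Hp = coeff_mat nz (stack ns nz UNIV Qineq)"
    and kp: "kp = rhs_vec (stack ns nz UNIV Qineq)"
    and Ie: "Ie = {j \<in> {ns..<nz}. is_linear_op (\<alpha> j)}"
    and Ir: "Ir = {..<nz} - Ie"
    and ne: "ne = card Ie"
    and nr: "nr = card Ir"
    and U: "U \<in> carrier_mat nz nz"
           "\<And>z. z \<in> carrier_vec nz \<Longrightarrow> U *\<^sub>v z = subvec z Ie @\<^sub>v subvec z Ir"
    and eqs_p: "eqs_p = stack ns nz Ie Qeq @ stack ns nz (- Ie) Qeq @ output_eqs El y"
    and A_dim: "Aee \<in> carrier_mat ne ne" "Aer \<in> carrier_mat ne nr"
               "Are \<in> carrier_mat mr ne" "Arr \<in> carrier_mat mr nr"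
    and A_blocks: "four_block_mat Aee Aer Are Arr = coeff_mat nz eqs_p * mat_inv U"
    and b_dim: "be \<in> carrier_vec ne" "br \<in> carrier_vec mr"
    and b_blocks: "be @\<^sub>v br = rhs_vec eqs_p"
    and H_dim: "He \<in> carrier_mat nh ne" "Hr \<in> carrier_mat nh nr"
    and H_blocks: "He @\<^sub>c Hr = Hp * mat_inv U"
    and E_dim: "Ee \<in> carrier_mat nx ne" "Er \<in> carrier_mat nx nr"
    and E_blocks: "Ee @\<^sub>c Er = Ef * mat_inv U"
    and Gf: "Gf = Er - Ee * mat_inv Aee * Aer"
    and cf: "cf = Ee * mat_inv Aee *\<^sub>v be"
    and Ho: "Ho = Hr - He * mat_inv Aee * Aer"
    and ko: "ko = kp - He * mat_inv Aee *\<^sub>v be"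
    and Ao: "Ao = Arr - Are * mat_inv Aee * Aer"
    and bo: "bo = br - Are * mat_inv Aee *\<^sub>v be"
    and Po: "Po = {z \<in> carrier_vec nr. Ho *\<^sub>v z \<le> ko \<and> Ao *\<^sub>v z = bo}"
    and Xk: "Xk = (\<lambda>z. Ef *\<^sub>v z) `
               ((Xprev \<times>\<^sub>v W \<times>\<^sub>v V \<times>\<^sub>v vec_box (drop ns Z)) \<inter> Pl \<inter> Py)"
    and Xk': "Xk' = (\<lambda>p. p + cf) ` ((\<lambda>z. Gf *\<^sub>v z) `
               ((Xprev \<times>\<^sub>v W \<times>\<^sub>v V \<times>\<^sub>v vec_box (drop ns (nths Z Ir))) \<inter> Po))"
  shows "Xk = Xk'"
proof -

  \<comment> \<open>Index sets and dimensions\<close>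
  have Ie_Ir: "finite Ie" "finite Ir" "Ie \<inter> Ir = {}" "Ie \<union> Ir = {..<nz}"
    and [simp]: "{ns..<nz} \<inter> Ie = Ie"
    and inputs: "{..<ns} \<subseteq> Ir" and ns_le: "ns \<le> nz"
    and args: "\<And>j. j \<in> {ns..<nz} \<Longrightarrow> op_args (\<alpha> j) \<subseteq> {..<j}"
    using fac by (auto simp: Ie Ir factors_def)
  have nz: "ne + nr = nz"
    using card_Un_disjoint[of Ie Ir] by (simp add: ne nr Ie_Ir)
  have S_carrier: "S \<subseteq> carrier_vec ns"
    unfolding S ns add.assoc
    by (intro vec_times_carrier constrained_zonotope_carrier Xprev(1) W(1) V(1))
  have Ef_carrier: "Ef \<in> carrier_mat nx nz" and El_carrier: "El \<in> carrier_mat ny nz"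
    using composite by (auto simp: first_f_then_g_def selection_mat_def Let_def)
  have ze_carrier: "subvec z Ie \<in> carrier_vec ne" and zr_carrier: "subvec z Ir \<in> carrier_vec nr"
    if "z \<in> carrier_vec nz" for z
  proof -
    have "{j. j < nz \<and> j \<in> Ie} = Ie" "{j. j < nz \<and> j \<in> Ir} = Ir"
      by (auto simp: Ie Ir)
    then show "subvec z Ie \<in> carrier_vec ne" "subvec z Ir \<in> carrier_vec nr"
      using that unfolding carrier_dim_vec dim_subvec by (simp_all add: ne nr)
  qed

  \<comment> \<open>The reordering \<open>U\<close> and its inverse\<close>
  have zero_append: "0\<^sub>v nz = 0\<^sub>v ne @\<^sub>v (0\<^sub>v nr :: real vec)"
    by (rule eq_vecI) (auto simp flip: nz)
  \<comment> \<open>Evaluating \<open>U\<close> at the zero vector yields the subvectors of zero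
    without computing with \<open>nths\<close>.\<close>
  have "U *\<^sub>v 0\<^sub>v nz = 0\<^sub>v nz"
    using U(1) by (intro eq_vecI) auto
  then have "subvec (0\<^sub>v nz) Ie @\<^sub>v subvec (0\<^sub>v nz) Ir = 0\<^sub>v ne @\<^sub>v (0\<^sub>v nr :: real vec)"
    unfolding U(2)[OF zero_carrier_vec, symmetric] zero_append[symmetric] .
  then have zero_parts: "subvec (0\<^sub>v nz) Ie = 0\<^sub>v ne" "subvec (0\<^sub>v nz) Ir = 0\<^sub>v nr"
    using append_vec_eq[OF ze_carrier, of "0\<^sub>v nz" "0\<^sub>v ne"] by auto
  have eq_zeroI: "z = 0\<^sub>v nz" if "z \<in> carrier_vec nz" "\<And>j. j < nz \<Longrightarrow> z $ j = 0" for z :: "real vec"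
    using that by (intro eq_vecI) auto
  have zero_on: "z $ j = 0"
    if "z \<in> carrier_vec nz" "subvec z I = subvec (0\<^sub>v nz) I" "j \<in> I" "j < nz" for z I j
    using subvec_eqD[OF that(2), of j] that by auto
  \<comment> \<open>\<open>U\<close> is given by its action only, so its invertibility goes through
    the kernel: both subvectors of \<open>v\<close> vanish, and every index lies in
    \<open>Ie\<close> or \<open>Ir\<close>.\<close>
  have "v = 0\<^sub>v nz" if v: "v \<in> carrier_vec nz" and 0: "U *\<^sub>v v = 0\<^sub>v nz" for v
  proof -
    have "subvec v Ie @\<^sub>v subvec v Ir = 0\<^sub>v ne @\<^sub>v 0\<^sub>v nr"
      using U(2)[OF v] 0 zero_append by simp
    then have parts: "subvec v Ie = subvec (0\<^sub>v nz) Ie" "subvec v Ir = subvec (0\<^sub>v nz) Ir"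
      using append_vec_eq[OF ze_carrier[OF v], of "0\<^sub>v ne"] by (auto simp: zero_parts)
    have "v $ j = 0" if "j < nz" for j
      using zero_on[OF v parts(1)] zero_on[OF v parts(2)] that Ie_Ir(4) by blast
    with v show ?thesis
      by (rule eq_zeroI)
  qed
  note Ui = mat_inv[OF U(1) this]
  \<comment> \<open>The blocks of the constraint and output matrices are cut out of products with
    \<open>mat_inv U\<close>; this identity lets them act on the two subvectors of
    \<open>z\<close>.\<close>
  have permute: "M *\<^sub>v z = (M * mat_inv U) *\<^sub>v (subvec z Ie @\<^sub>v subvec z Ir)"
    if "M \<in> carrier_mat k nz" "z \<in> carrier_vec nz" for M k z
  proof -
    have "M * mat_inv U *\<^sub>v (U *\<^sub>v z) = M *\<^sub>v (mat_inv U * U *\<^sub>v z)"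
      using that U(1) Ui(1) by (simp add: assoc_mult_mat_vec[of _ _ nz _ nz])
    then show ?thesis
      using that by (simp add: Ui(3) U(2))
  qed
  \<comment> \<open>Surjectivity of the reordering: it supplies full vectors with prescribed
    eliminated and retained parts.\<close>
  have unpermute: "\<exists>z \<in> carrier_vec nz. subvec z Ie = v \<and> subvec z Ir = r"
    if v: "v \<in> carrier_vec ne" and r: "r \<in> carrier_vec nr" for v r
  proof
    let ?z = "mat_inv U *\<^sub>v (v @\<^sub>v r)"
    have vr: "v @\<^sub>v r \<in> carrier_vec nz"
      using v r nz by auto
    then show z: "?z \<in> carrier_vec nz"
      using Ui(1) by auto
    have "U *\<^sub>v ?z = U * mat_inv U *\<^sub>v (v @\<^sub>v r)"
      by (rule assoc_mult_mat_vec[OF U(1) Ui(1) vr, symmetric])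
    also have "\<dots> = v @\<^sub>v r"
      using vr by (simp add: Ui(2))
    finally have "subvec ?z Ie @\<^sub>v subvec ?z Ir = v @\<^sub>v r"
      using U(2)[OF z] by simp
    then show "subvec ?z Ie = v \<and> subvec ?z Ir = r"
      using append_vec_eq[OF ze_carrier[OF z] v] by auto
  qed

  \<comment> \<open>The polyhedron as one linear system\<close>
  define ineqs eqs_e eqs_r
    where "ineqs = stack ns nz UNIV Qineq" and "eqs_e = stack ns nz Ie Qeq"
      and "eqs_r = stack ns nz (- Ie) Qeq @ output_eqs El y"
  have coeffs: "fst ` set ineqs \<subseteq> carrier_vec nz" "fst ` set eqs_e \<subseteq> carrier_vec nz"
    "fst ` set eqs_r \<subseteq> carrier_vec nz"
    unfolding ineqs_def eqs_e_def eqs_r_def set_append image_Un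
    by (intro Un_least fst_stack fst_output_eqs[OF El_carrier];
        use Q_dim in \<open>force simp: split_paired_all\<close>)+
  have eqs_p': "eqs_p = eqs_e @ eqs_r"
    by (simp add: eqs_p eqs_e_def eqs_r_def)
  have Pl_Py_iff: "z \<in> Pl \<inter> Py \<longleftrightarrow> Hp *\<^sub>v z \<le> kp \<and> coeff_mat nz eqs_p *\<^sub>v z = rhs_vec eqs_p"
    if z: "z \<in> carrier_vec nz" for z
  proof -
    have "Hp *\<^sub>v z \<le> kp \<longleftrightarrow> (\<forall>j \<in> {ns..<nz}. \<forall>(a, c) \<in> set (Qineq j). a \<bullet> z \<le> c)"
      unfolding Hp kp using coeff_mat_mult_vec_le_iff[OF coeffs(1)]
      by (simp add: ineqs_def set_stack)
    moreover have "coeff_mat nz eqs_p *\<^sub>v z = rhs_vec eqs_p \<longleftrightarrow>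
        (\<forall>(a, c) \<in> set eqs_p. a \<bullet> z = c)"
      using coeffs by (intro coeff_mat_mult_vec_eq_iff) (auto simp: eqs_p')
    moreover have "\<dots> \<longleftrightarrow> (\<forall>j \<in> {ns..<nz}. \<forall>(a, c) \<in> set (Qeq j). a \<bullet> z = c) \<and> El *\<^sub>v z = y"
    proof -
      \<comment> \<open>Satisfaction depends only on the set of rows, so moving the equalities of
        \<open>Ie\<close> to the front changes nothing.\<close>
      have "set eqs_p = (\<Union>j \<in> {ns..<nz}. set (Qeq j)) \<union> set (output_eqs El y)"
        unfolding eqs_p set_append set_stack by (auto simp: Ie)
      then show ?thesis
        unfolding output_eqs_iff[OF El_carrier y, symmetric] by (simp add: ball_Un)
    qed
    ultimately show ?thesis
      using z by (auto simp: Pl Py polyhedron_def)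
  qed

  \<comment> \<open>Equalities of the eliminated factors and the row blocks\<close>
  have linear_eq: "\<exists>p c. Qeq j = [(p, c)] \<and> (\<forall>z \<in> carrier_vec nz.
      (p \<bullet> z = c \<longrightarrow> op_value (\<alpha> j) z = Some (z $ j)) \<and>
      (p \<bullet> z = 0 \<longrightarrow> (\<forall>a \<in> op_args (\<alpha> j). z $ a = 0) \<longrightarrow> z $ j = 0))" if "j \<in> Ie" for j
  proof (rule linear_op_equation)
    have j: "ns \<le> j" "j < nz"
      using that by (auto simp: Ie)
    show "is_linear_op (\<alpha> j)" "op_args (\<alpha> j) \<subseteq> {..<j}" "j < nz"
      using that args j by (auto simp: Ie)
  qed (use that Q_plus Q_minus Q_shift Q_scale in \<open>auto simp: Ie\<close>)
  have "length (stack ns nz Ie Qeq) = card ({ns..<nz} \<inter> Ie)"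
    using linear_eq by (intro length_stack_singletons) fastforce
  then have length_e: "length eqs_e = ne"
    by (simp add: eqs_e_def ne)
  \<comment> \<open>Since \<open>eqs_e\<close> has \<open>ne\<close> rows, both concatenations are
    cut at the same place and their halves agree.\<close>
  have rhs: "be = rhs_vec eqs_e" "br = rhs_vec eqs_r"
    using b_blocks append_vec_eq[OF b_dim(1), of "rhs_vec eqs_e"] length_e rhs_vec_carrier[of eqs_e]
    by (simp_all add: eqs_p' rhs_vec_append)
  \<comment> \<open>This ties the blocks to the constraint rows, so that \<open>Aee\<close> can be
    studied through the equations in \<open>eqs_e\<close> instead of its triangular shape.\<close>
  have block_rows: "coeff_mat nz eqs_e *\<^sub>v z = Aee *\<^sub>v subvec z Ie + Aer *\<^sub>v subvec z Ir"
    "coeff_mat nz eqs_r *\<^sub>v z = Are *\<^sub>v subvec z Ie + Arr *\<^sub>v subvec z Ir"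
    if z: "z \<in> carrier_vec nz" for z
  proof -
    have "coeff_mat nz eqs_e *\<^sub>v z @\<^sub>v coeff_mat nz eqs_r *\<^sub>v z = coeff_mat nz eqs_p *\<^sub>v z"
      unfolding eqs_p' using coeffs by (intro coeff_mat_append_mult_vec[symmetric])
    also have "\<dots> = (coeff_mat nz eqs_p * mat_inv U) *\<^sub>v (subvec z Ie @\<^sub>v subvec z Ir)"
      by (rule permute[OF coeff_mat_carrier z])
    also have "\<dots> = (Aee *\<^sub>v subvec z Ie + Aer *\<^sub>v subvec z Ir) @\<^sub>v
        (Are *\<^sub>v subvec z Ie + Arr *\<^sub>v subvec z Ir)"
      unfolding A_blocks[symmetric]
      by (rule four_block_mat_mult_vec[OF A_dim ze_carrier[OF z] zr_carrier[OF z]])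
    finally have *: "coeff_mat nz eqs_e *\<^sub>v z @\<^sub>v coeff_mat nz eqs_r *\<^sub>v z = \<dots>" .
    have "coeff_mat nz eqs_e *\<^sub>v z \<in> carrier_vec ne"
      using mult_mat_vec_carrier[OF coeff_mat_carrier z, of eqs_e] length_e by simp
    moreover have "Aee *\<^sub>v subvec z Ie + Aer *\<^sub>v subvec z Ir \<in> carrier_vec ne"
      using A_dim ze_carrier[OF z] zr_carrier[OF z] by auto
    ultimately show "coeff_mat nz eqs_e *\<^sub>v z = Aee *\<^sub>v subvec z Ie + Aer *\<^sub>v subvec z Ir"
      "coeff_mat nz eqs_r *\<^sub>v z = Are *\<^sub>v subvec z Ie + Arr *\<^sub>v subvec z Ir"
      using * append_vec_eq by blast+
  qed

  \<comment> \<open>Invertibility of \<open>Aee\<close>\<close>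
  have "v = 0\<^sub>v ne" if v: "v \<in> carrier_vec ne" and 0: "Aee *\<^sub>v v = 0\<^sub>v ne" for v
  proof -
    \<comment> \<open>Extending \<open>v\<close> by zero on \<open>Ir\<close> turns a kernel vector
      of \<open>Aee\<close> into a solution of the homogeneous equations of
      \<open>eqs_e\<close>.\<close>
    obtain z where z: "z \<in> carrier_vec nz" and zv: "subvec z Ie = v" and z0: "subvec z Ir = 0\<^sub>v nr"
      using unpermute[OF v zero_carrier_vec] by blast
    have "coeff_mat nz eqs_e *\<^sub>v z = 0\<^sub>v ne"
      unfolding block_rows(1)[OF z] zv z0 0 using A_dim by (intro eq_vecI) auto
    then have "fst (eqs_e ! i) \<bullet> z = 0" if "i < ne" for i
      using that coeff_mat_mult_vec_index[OF coeffs(2), of i z] by (simp add: length_e)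
    then have homogeneous: "p \<bullet> z = 0" if "(p, c) \<in> set eqs_e" for p c
      using that by (metis fst_conv in_set_conv_nth length_e)
    \<comment> \<open>Forward substitution: components in \<open>Ir\<close> vanish by the choice of
      \<open>z\<close>, the others because the arguments of an operation precede its result.\<close>
    have "z $ j = 0" if "j < nz" for j
      using that
    proof (induction j rule: less_induct)
      case (less j)
      show ?case
      proof (cases "j \<in> Ie")
        case True
        then obtain p c where Qj: "Qeq j = [(p, c)]"
          and p: "p \<bullet> z = 0 \<Longrightarrow> (\<forall>a \<in> op_args (\<alpha> j). z $ a = 0) \<Longrightarrow> z $ j = 0"
          using linear_eq z by blast
        have "(p, c) \<in> set eqs_e"
          using True Qj by (auto simp: eqs_e_def set_stack intro!: bexI[of _ j])
        moreover have "\<forall>a \<in> op_args (\<alpha> j). z $ a = 0"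
          using less args[of j] True by (auto simp: Ie)
        ultimately show ?thesis
          using p homogeneous by blast
      next
        case False
        then show ?thesis
          using zero_on[OF z, of Ir j] z0 zero_parts(2) less.prems Ie_Ir(4) by auto
      qed
    qed
    then have "z = 0\<^sub>v nz"
      using z by (intro eq_zeroI)
    then show ?thesis
      using zv zero_parts by simp
  qed
  note B = mat_inv[OF A_dim(1) this]

  \<comment> \<open>Solving for the eliminated components\<close>
  define elim where "elim r = mat_inv Aee *\<^sub>v (be - Aer *\<^sub>v r)" for r
  have elim_carrier: "elim r \<in> carrier_vec ne" if "r \<in> carrier_vec nr" for r
    unfolding elim_def using that A_dim b_dim B(1) by auto
  \<comment> \<open>Given the retained part \<open>r\<close>, \<open>elim r\<close> is the only
    admissible eliminated part. Uniqueness uses the left inverse, existence the right one.\<close>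
  have elim_iff: "Aee *\<^sub>v v + Aer *\<^sub>v r = be \<longleftrightarrow> v = elim r"
    if v: "v \<in> carrier_vec ne" and r: "r \<in> carrier_vec nr" for v r
  proof -
    have d: "be - Aer *\<^sub>v r \<in> carrier_vec ne"
      using A_dim b_dim r by auto
    have "Aee *\<^sub>v v + Aer *\<^sub>v r = be \<longleftrightarrow> Aee *\<^sub>v v = be - Aer *\<^sub>v r"
      using A_dim b_dim v r by (intro add_vec_eq_iff_eq_minus[of _ ne]) auto
    also have "\<dots> \<longleftrightarrow> v = elim r"
    proof
      assume "Aee *\<^sub>v v = be - Aer *\<^sub>v r"
      then have "elim r = mat_inv Aee * Aee *\<^sub>v v"
        unfolding elim_def using assoc_mult_mat_vec[OF B(1) A_dim(1) v] by simp
      then show "v = elim r"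
        using v by (simp add: B(3))
    next
      assume "v = elim r"
      then have "Aee *\<^sub>v v = Aee * mat_inv Aee *\<^sub>v (be - Aer *\<^sub>v r)"
        unfolding elim_def using assoc_mult_mat_vec[OF A_dim(1) B(1) d] by simp
      then show "Aee *\<^sub>v v = be - Aer *\<^sub>v r"
        using d by (simp add: B(2))
    qed
    finally show ?thesis .
  qed
  have subst_carrier: "(M\<^sub>r - M\<^sub>e * mat_inv Aee * Aer) *\<^sub>v r \<in> carrier_vec k"
    "M\<^sub>e * mat_inv Aee *\<^sub>v be \<in> carrier_vec k"
    if "M\<^sub>e \<in> carrier_mat k ne" "M\<^sub>r \<in> carrier_mat k nr" "r \<in> carrier_vec nr" for M\<^sub>e M\<^sub>r k r
    using that A_dim b_dim B(1)
    by (blast intro: mult_mat_vec_carrier minus_carrier_mat mult_carrier_mat)+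
  \<comment> \<open>The pair (\<open>Ee\<close>, \<open>Er\<close>) leads to \<open>Gf\<close> and
    \<open>cf\<close>, (\<open>He\<close>, \<open>Hr\<close>) to \<open>Ho\<close> and
    \<open>ko\<close>, (\<open>Are\<close>, \<open>Arr\<close>) to \<open>Ao\<close> and
    \<open>bo\<close>.\<close>
  have subst: "M\<^sub>e *\<^sub>v elim r + M\<^sub>r *\<^sub>v r = (M\<^sub>r - M\<^sub>e * mat_inv Aee * Aer) *\<^sub>v r + M\<^sub>e * mat_inv Aee *\<^sub>v be"
    if "M\<^sub>e \<in> carrier_mat k ne" "M\<^sub>r \<in> carrier_mat k nr" "r \<in> carrier_vec nr" for M\<^sub>e M\<^sub>r k r
    unfolding elim_def using that A_dim b_dim B(1) by (intro substitute_mult_vec)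

  \<comment> \<open>The reduced constraints and the reduced output map\<close>
  have nh: "length ineqs = nh"
    using arg_cong[OF H_blocks, of dim_row] H_dim by (simp add: append_cols_def Hp ineqs_def)
  have Hp_carrier: "Hp \<in> carrier_mat nh nz" and kp_carrier: "kp \<in> carrier_vec nh"
    unfolding Hp kp nh[symmetric] ineqs_def[symmetric] by (rule coeff_mat_carrier rhs_vec_carrier)+
  \<comment> \<open>Every point of the original polyhedron has the eliminated form, so the
    equivalences in \<open>reduced\<close> apply to it.\<close>
  have solution: "subvec z Ie = elim (subvec z Ir)" if "z \<in> Pl \<inter> Py" for z
  proof -
    have z: "z \<in> carrier_vec nz"
      using that by (auto simp: Py)
    have "\<forall>(a, c) \<in> set eqs_p. a \<bullet> z = c"
      using that Pl_Py_iff[OF z] coeff_mat_mult_vec_eq_iff[of eqs_p nz z] coeffs(2,3)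
      by (auto simp: eqs_p' image_Un)
    then have "coeff_mat nz eqs_e *\<^sub>v z = be"
      unfolding rhs coeff_mat_mult_vec_eq_iff[OF coeffs(2)] by (auto simp: eqs_p')
    then show ?thesis
      using elim_iff[OF ze_carrier[OF z] zr_carrier[OF z]] block_rows(1)[OF z] by simp
  qed
  have reduced: "z \<in> Pl \<inter> Py \<longleftrightarrow> subvec z Ir \<in> Po" "Ef *\<^sub>v z = Gf *\<^sub>v subvec z Ir + cf"
    if z: "z \<in> carrier_vec nz" and ze: "subvec z Ie = elim (subvec z Ir)" for z
  proof -
    define r where "r = subvec z Ir"
    have r: "r \<in> carrier_vec nr" and v: "elim r \<in> carrier_vec ne"
      using zr_carrier[OF z] elim_carrier by (simp_all add: r_def)
    have "Ef *\<^sub>v z = Ee *\<^sub>v elim r + Er *\<^sub>v r"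
      unfolding permute[OF Ef_carrier z] E_blocks[symmetric] ze r_def[symmetric]
      by (rule append_cols_mult_vec[OF E_dim v r])
    then show "Ef *\<^sub>v z = Gf *\<^sub>v subvec z Ir + cf"
      unfolding r_def[symmetric] by (simp add: subst[OF E_dim r] Gf cf)
    have "Hp *\<^sub>v z = He *\<^sub>v elim r + Hr *\<^sub>v r"
      unfolding permute[OF Hp_carrier z] H_blocks[symmetric] ze r_def[symmetric]
      by (rule append_cols_mult_vec[OF H_dim v r])
    also have "\<dots> = Ho *\<^sub>v r + He * mat_inv Aee *\<^sub>v be"
      unfolding Ho by (rule subst[OF H_dim r])
    finally have "Hp *\<^sub>v z \<le> kp \<longleftrightarrow> Ho *\<^sub>v r \<le> ko"
      unfolding ko Ho using add_vec_le_iff_le_minus[OF subst_carrier[OF H_dim r] kp_carrier] by simp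
    moreover have "coeff_mat nz eqs_p *\<^sub>v z = rhs_vec eqs_p \<longleftrightarrow> Ao *\<^sub>v r = bo"
    proof -
      \<comment> \<open>The first \<open>ne\<close> equalities hold by the choice of
        \<open>elim r\<close>; only the rows in \<open>eqs_r\<close> survive as conditions on
        \<open>r\<close>.\<close>
      have e: "coeff_mat nz eqs_e *\<^sub>v z = be"
        using elim_iff[OF v r] by (simp add: block_rows(1)[OF z] ze flip: r_def)
      have "coeff_mat nz eqs_p *\<^sub>v z = rhs_vec eqs_p \<longleftrightarrow>
          be @\<^sub>v coeff_mat nz eqs_r *\<^sub>v z = be @\<^sub>v br"
        unfolding b_blocks eqs_p' coeff_mat_append_mult_vec[OF coeffs(2,3)] e ..
      also have "\<dots> \<longleftrightarrow> coeff_mat nz eqs_r *\<^sub>v z = br"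
        using append_vec_eq[OF b_dim(1) b_dim(1)] by simp
      also have "coeff_mat nz eqs_r *\<^sub>v z = Are *\<^sub>v elim r + Arr *\<^sub>v r"
        by (simp add: block_rows(2)[OF z] ze flip: r_def)
      also have "\<dots> = Ao *\<^sub>v r + Are * mat_inv Aee *\<^sub>v be"
        unfolding Ao by (rule subst[OF A_dim(3,4) r])
      also have "\<dots> = br \<longleftrightarrow> Ao *\<^sub>v r = bo"
        unfolding bo Ao by (rule add_vec_eq_iff_eq_minus[OF subst_carrier[OF A_dim(3,4) r] b_dim(2)])
      finally show ?thesis .
    qed
    ultimately show "z \<in> Pl \<inter> Py \<longleftrightarrow> subvec z Ir \<in> Po"
      unfolding Pl_Py_iff[OF z] using r by (simp add: Po flip: r_def)
  qed

  \<comment> \<open>Redundancy of the bounds on eliminated factors\<close>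
  have in_box: "z \<in> S \<times>\<^sub>v vec_box (drop ns Z) \<longleftrightarrow>
      subvec z Ir \<in> S \<times>\<^sub>v vec_box (drop ns (nths Z Ir))"
    if zP: "z \<in> Pl \<inter> Py" for z
  proof -
    have z: "z \<in> carrier_vec nz"
      using zP by (auto simp: Py)
    \<comment> \<open>The induction follows the order of computation: inputs are bounded by the hull
      of \<open>S\<close>, retained factors by assumption, eliminated ones by interval
      evaluation.\<close>
    have "z $ j \<in> Z ! j" if first: "vec_first z ns \<in> S"
      and Zr: "\<forall>j \<in> {ns..<nz} \<inter> Ir. z $ j \<in> Z ! j" and "j < nz" for j
      using \<open>j < nz\<close>
    proof (induction j rule: less_induct)
      case (less j)
      consider "j < ns" | "j \<in> {ns..<nz} \<inter> Ir" | "j \<in> Ie"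
        using less.prems by (force simp: Ir)
      then show ?case
      proof cases
        case 1
        then have "z $ j = vec_first z ns $ j"
          by (simp add: vec_first_def)
        then show ?thesis
          using first subset_interval_hull[of S] Z_in[OF 1] by auto
      next
        case 2
        then show ?thesis
          using Zr by blast
      next
        case 3
        then have j: "ns \<le> j" "j < nz"
          by (auto simp: Ie)
        obtain p c where Qj: "Qeq j = [(p, c)]"
          and p: "p \<bullet> z = c \<Longrightarrow> op_value (\<alpha> j) z = Some (z $ j)"
          using linear_eq[OF 3] z by blast
        \<comment> \<open>A point of the polyhedron need not be a vector of factors, but for a
          linear operation \<open>Qeq j\<close> is the exact relation, so \<open>z $ j\<close> is
          still the value of the operation at \<open>z\<close>.\<close>
        have "z \<in> polyhedron nz (Qineq j) (Qeq j)"
          using zP j by (auto simp: Pl)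
        then have "op_value (\<alpha> j) z = Some (z $ j)"
          using p Qj by (simp add: polyhedron_def)
        then show ?thesis
        proof (rule op_value_mem_op_interval[OF Z_op[OF j]])
          fix a assume "a \<in> op_args (\<alpha> j)"
          then have "a < j"
            using args[of j] j by auto
          then show "z $ a \<in> Z ! a"
            using less.IH j by simp
        qed
      qed
    qed
    \<comment> \<open>With \<open>UNIV\<close> as index set the box lemma describes the original
      set; the extra bounds for \<open>Ie\<close> were just derived from the others.\<close>
    moreover have "nths Z UNIV = Z"
      by (simp add: nths_all)
    ultimately show ?thesis
      using subvec_mem_times_box_iff[OF S_carrier, of z Z UNIV]
        subvec_mem_times_box_iff[OF S_carrier, of z Z Ir] z ns_le inputs Z_length
      by auto
  qed

  \<comment> \<open>The two inclusions\<close>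
  have S_times: "Xprev \<times>\<^sub>v W \<times>\<^sub>v V \<times>\<^sub>v B = S \<times>\<^sub>v B" for B
    by (simp add: S vec_times_assoc)
  show "Xk = Xk'"
  proof (intro equalityI subsetI)
    fix x assume "x \<in> Xk"
    then obtain z where x: "x = Ef *\<^sub>v z" and zS: "z \<in> S \<times>\<^sub>v vec_box (drop ns Z)" and zP: "z \<in> Pl \<inter> Py"
      unfolding Xk S_times by auto
    have z: "z \<in> carrier_vec nz"
      using zP by (auto simp: Py)
    \<comment> \<open>The witness is \<open>subvec z Ir\<close>, whose reduced image is that of
      \<open>z\<close>.\<close>
    show "x \<in> Xk'"
      unfolding Xk' S_times image_image x reduced(2)[OF z solution[OF zP]]
      using zS zP in_box[OF zP] reduced(1)[OF z solution[OF zP]] by blast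
  next
    fix x assume "x \<in> Xk'"
    then obtain r where x: "x = Gf *\<^sub>v r + cf"
      and rS: "r \<in> S \<times>\<^sub>v vec_box (drop ns (nths Z Ir))" and rP: "r \<in> Po"
      unfolding Xk' S_times by auto
    have "r \<in> carrier_vec nr"
      using rP by (simp add: Po)
    \<comment> \<open>A reduced point \<open>r\<close> is lifted by computing its eliminated
      components with \<open>elim\<close>.\<close>
    then obtain z where z: "z \<in> carrier_vec nz" and ze: "subvec z Ie = elim r" and zr: "subvec z Ir = r"
      using unpermute[OF elim_carrier, of r r] by blast
    have zP: "z \<in> Pl \<inter> Py" and xz: "x = Ef *\<^sub>v z"
      using reduced[OF z] ze zr rP x by auto
    then show "x \<in> Xk"
      unfolding Xk S_times using rS in_box[OF zP] zr by blast
  qed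
qed

end
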